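(* Let $H$ be a finite dimensional Hilbert space, let $\mathcal K$ be a symmetric mapping cone on $B(H)$, and let $\rho$ be a linear functional on $B(H\otimes H)$ with density operator $h$. Then the following conditions are equivalent. (i) $\rho=\tilde\phi$ with $\phi\in\mathcal K^\circ$. (ii) $\rho(C_\alpha)\ge 0$ for all $\alpha\in\mathcal K$. (iii) $(\iota\otimes\alpha)(h)\ge 0$ for all $\alpha\in\mathcal K$. (iv) $\rho\circ(\iota\otimes\alpha)\ge 0$ for all $\alpha\in\mathcal K$. (v) $\rho$ is positive on the cone $\{x\in B(H\otimes H): (\iota\otimes\alpha)(x)\ge 0\ \ \forall\,\alpha\in\mathcal K^\circ\}$.
   Context: $H$ is a finite dimensional complex Hilbert space with a fixed orthonormal basis, $(e_{ij})$ are the corresponding matrix units of $B(H)$, $t$ (also written $x\mapsto x^t$) is the transpose map on $B(H)$ with respect to this basis, $Tr$ is the usual trace, and $\iota$ is the identity map of $B(H)$. $P(H)$ is the cone of positive linear maps $B(H)\to B(H)$ and $CP(H)\subset P(H)$ the cone of completely positive maps. Cones are convex. A mapping cone (on $B(H)$) is a nonzero closed subcone $\mathcal K$ of $P(H)$ such that for all $\phi\in\mathcal K$ and $\alpha,\beta\in CP(H)$ we have $\alpha\circ\phi\in\mathcal K$ and $\phi\circ\beta\in\mathcal K$. For $\phi\in P(H)$, $\phi^*$ is the adjoint map defined by $Tr(\phi(a)b)=Tr(a\phi^*(b))$ for all $a,b\in B(H)$, and $\phi^t=t\circ\phi\circ t$. A mapping cone $\mathcal K$ is symmetric if for every $\phi\in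 P(H)$: $\phi\in\mathcal K \Leftrightarrow \phi^*\in\mathcal K\Leftrightarrow \phi^t\in\mathcal K$. The Choi matrix of a linear map $\phi:B(H)\to B(H)$ is $C_\phi=\sum_{i,j}e_{ij}\otimes\phi(e_{ij})\in B(H)\otimes B(H)=B(H\otimes H)$. The dual cone of $\mathcal K$ is $\mathcal K^\circ=\{\phi\in P(H): Tr(C_\phi C_\alpha)\ge 0\ \ \forall\,\alpha\in\mathcal K\}$. For a linear map $\phi:B(H)\to B(H)$, $\tilde\phi$ is the linear functional on $B(H)\otimes B(H)$ determined by $\tilde\phi(a\otimes b)=Tr(\phi(a)b^t)$. The density operator of $\rho$ is the operator $h\in B(H\otimes H)$ with $\rho(x)=Tr(hx)$ for all $x$. A linear functional is $\geq 0$ if it is nonnegative on all positive operators, and is positive on a set if it takes values $\ge 0$ on that set. *)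

theory Defs
  imports "HOL-Analysis.Analysis"
begin

text \<open>
  A finite dimensional Hilbert space \<open>H\<close> with a fixed orthonormal basis indexed by a finite type
  \<open>'n\<close> is \<open>complex ^ 'n\<close>; \<open>B(H)\<close> is the type of \<open>'n \<times> 'n\<close> complex matrices, and \<open>B(H \<otimes> H)\<close> the
  type of matrices indexed by pairs, the first component belonging to the first tensor factor.
  The library operation \<open>*s\<close> on \<open>complex ^ 'n ^ 'n\<close> scales by vectors, hence \<open>cscale\<close>.
\<close>

type_synonym 'n op = "complex ^ 'n ^ 'n"
type_synonym 'n opmap = "'n op \<Rightarrow> 'n op"

definition cscale :: "complex \<Rightarrow> ('n::finite) op \<Rightarrow> 'n op" where
  "cscale c A = (\<chi> i j. c * A $ i $ j)"

abbreviation clinear_map :: "(('m::finite) op \<Rightarrow> ('n::finite) op) \<Rightarrow> bool" where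
  "clinear_map \<equiv> Vector_Spaces.linear cscale cscale"

abbreviation clinear_functional :: "(('m::finite) op \<Rightarrow> complex) \<Rightarrow> bool" where
  "clinear_functional \<equiv> Vector_Spaces.linear cscale (*)"

definition cinner :: "complex ^ ('n::finite) \<Rightarrow> complex ^ 'n \<Rightarrow> complex" where
  "cinner u v = (\<Sum>i\<in>UNIV. u $ i * cnj (v $ i))"

definition psd :: "('n::finite) op \<Rightarrow> bool" where
  "psd A \<longleftrightarrow> (\<forall>v. cinner (A *v v) v \<in> \<real>\<^sub>\<ge>\<^sub>0)"

definition functional_nonneg :: "(('n::finite) op \<Rightarrow> complex) \<Rightarrow> bool" where
  "functional_nonneg f \<longleftrightarrow> (\<forall>A. psd A \<longrightarrow> f A \<in> \<real>\<^sub>\<ge>\<^sub>0)"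

definition matrix_unit :: "'n::finite \<Rightarrow> 'n \<Rightarrow> 'n op" where
  "matrix_unit i j = (\<chi> k l. if k = i \<and> l = j then 1 else 0)"

definition tensor :: "('m::finite) op \<Rightarrow> ('n::finite) op \<Rightarrow> ('m \<times> 'n) op" (infixr "\<otimes>\<^sub>m" 70) where
  "a \<otimes>\<^sub>m b = (\<chi> p q. a $ fst p $ fst q * b $ snd p $ snd q)"

definition pos_maps :: "('n::finite) opmap set" where
  "pos_maps = {\<phi>. clinear_map \<phi> \<and> (\<forall>A. psd A \<longrightarrow> psd (\<phi> A))}"

text \<open>
  Complete positivity: \<open>\<phi>\<close> maps positive \<open>k \<times> k\<close> block matrices over \<open>B(H)\<close> entrywise to positive
  ones, for every \<open>k\<close>. Since \<open>k\<close> is quantified, block matrices are functions of natural number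
  indices of which only those below \<open>k\<close> matter.
\<close>

definition block_psd :: "nat \<Rightarrow> (nat \<Rightarrow> nat \<Rightarrow> ('n::finite) op) \<Rightarrow> bool" where
  "block_psd k A \<longleftrightarrow>
     (\<forall>v :: nat \<Rightarrow> complex ^ 'n. (\<Sum>i<k. \<Sum>j<k. cinner (A i j *v v j) (v i)) \<in> \<real>\<^sub>\<ge>\<^sub>0)"

definition cp_maps :: "('n::finite) opmap set" where
  "cp_maps = {\<phi>. clinear_map \<phi> \<and> (\<forall>k A. block_psd k A \<longrightarrow> block_psd k (\<lambda>i j. \<phi> (A i j)))}"

text \<open>
  Below, \<open>closed\<close> refers to the product topology on functions, that is, to pointwise convergence.
  On the finite dimensional space of linear maps, a closed subset of all functions, it agrees with
  the norm topology.
\<close>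

definition mapping_cone :: "('n::finite) opmap set \<Rightarrow> bool" where
  "mapping_cone K \<longleftrightarrow>
     K \<subseteq> pos_maps \<and>
     (\<forall>\<phi>\<in>K. \<forall>\<psi>\<in>K. (\<lambda>x. \<phi> x + \<psi> x) \<in> K) \<and>
     (\<forall>\<phi>\<in>K. \<forall>r::real. r \<ge> 0 \<longrightarrow> (\<lambda>x. r *\<^sub>R \<phi> x) \<in> K) \<and>
     (\<exists>\<phi>\<in>K. \<phi> \<noteq> (\<lambda>x. 0)) \<and>
     closed K \<and>
     (\<forall>\<phi>\<in>K. \<forall>\<alpha>\<in>cp_maps. \<alpha> \<circ> \<phi> \<in> K) \<and>
     (\<forall>\<phi>\<in>K. \<forall>\<beta>\<in>cp_maps. \<phi> \<circ> \<beta> \<in> K)"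

definition adjoint_map :: "('n::finite) opmap \<Rightarrow> 'n opmap" where
  "adjoint_map \<phi> = (THE \<psi>. \<forall>a b. trace (\<phi> a ** b) = trace (a ** \<psi> b))"

definition transpose_map :: "('n::finite) opmap \<Rightarrow> 'n opmap" where
  "transpose_map \<phi> = transpose \<circ> \<phi> \<circ> transpose"

definition symmetric_cone :: "('n::finite) opmap set \<Rightarrow> bool" where
  "symmetric_cone K \<longleftrightarrow>
     (\<forall>\<phi>\<in>pos_maps. (\<phi> \<in> K \<longleftrightarrow> adjoint_map \<phi> \<in> K) \<and> (adjoint_map \<phi> \<in> K \<longleftrightarrow> transpose_map \<phi> \<in> K))"

definition choi :: "('n::finite) opmap \<Rightarrow> ('n \<times> 'n) op" where
  "choi \<phi> = (\<Sum>i\<in>UNIV. \<Sum>j\<in>UNIV. matrix_unit i j \<otimes>\<^sub>m \<phi> (matrix_unit i j))"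

definition dual_cone :: "('n::finite) opmap set \<Rightarrow> 'n opmap set" where
  "dual_cone K = {\<phi> \<in> pos_maps. \<forall>\<alpha>\<in>K. trace (choi \<phi> ** choi \<alpha>) \<in> \<real>\<^sub>\<ge>\<^sub>0}"

definition tilde :: "('n::finite) opmap \<Rightarrow> ('n \<times> 'n) op \<Rightarrow> complex" where
  "tilde \<phi> = (THE f. clinear_functional f \<and> (\<forall>a b. f (a \<otimes>\<^sub>m b) = trace (\<phi> a ** transpose b)))"

definition tensor_map :: "('n::finite) opmap \<Rightarrow> 'n opmap \<Rightarrow> ('n \<times> 'n) opmap" where
  "tensor_map \<phi> \<psi> = (THE F. clinear_map F \<and> (\<forall>a b. F (a \<otimes>\<^sub>m b) = \<phi> a \<otimes>\<^sub>m \<psi> b))"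

definition is_density :: "(('n::finite) op \<Rightarrow> complex) \<Rightarrow> 'n op \<Rightarrow> bool" where
  "is_density \<rho> h \<longleftrightarrow> (\<forall>x. \<rho> x = trace (h ** x))"


text \<open>For linear maps the definite descriptions above are proper, with explicit formulas.\<close>

lemma vector_space_cscale: "vector_space (cscale :: complex \<Rightarrow> ('n::finite) op \<Rightarrow> 'n op)"
  by unfold_locales (simp_all add: cscale_def vec_eq_iff algebra_simps)

lemma vector_space_times: "vector_space ((*) :: complex \<Rightarrow> complex \<Rightarrow> complex)"
  by unfold_locales (simp_all add: algebra_simps)

lemma clinear_map_iff:
  "clinear_map f \<longleftrightarrow> (\<forall>a b. f (a + b) = f a + f b) \<and> (\<forall>c a. f (cscale c a) = cscale c (f a))"
  by (simp add: Vector_Spaces.linear_iff vector_space_cscale)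

lemma clinear_functional_iff:
  "clinear_functional f \<longleftrightarrow> (\<forall>a b. f (a + b) = f a + f b) \<and> (\<forall>c a. f (cscale c a) = c * f a)"
  by (simp add: Vector_Spaces.linear_iff vector_space_cscale vector_space_times)

lemma sum_UNIV_prod:
  "(\<Sum>p\<in>(UNIV :: ('a::finite \<times> 'b::finite) set). f p) = (\<Sum>i\<in>UNIV. \<Sum>j\<in>UNIV. f (i, j))"
  unfolding UNIV_Times_UNIV[symmetric] by (subst sum.cartesian_product) simp

lemma op_expand:
  fixes X :: "('n::finite) op"
  shows "X = (\<Sum>i\<in>UNIV. \<Sum>j\<in>UNIV. cscale (X $ i $ j) (matrix_unit i j))"
proof -
  have "(\<Sum>i\<in>UNIV. \<Sum>j\<in>UNIV. cscale (X $ i $ j) (matrix_unit i j)) $ k $ l = X $ k $ l" for k l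
  proof -
    have "(\<Sum>i\<in>UNIV. \<Sum>j\<in>UNIV. cscale (X $ i $ j) (matrix_unit i j)) $ k $ l
        = (\<Sum>i\<in>UNIV. \<Sum>j\<in>UNIV. if k = i then (if l = j then X $ i $ j else 0) else 0)"
      unfolding cscale_def matrix_unit_def by (simp, intro sum.cong refl) auto
    also have "\<dots> = (\<Sum>i\<in>UNIV. if k = i then X $ i $ l else 0)"
      by (intro sum.cong refl) auto
    finally show ?thesis by simp
  qed
  then show ?thesis by (simp add: vec_eq_iff)
qed

lemma matrix_unit_tensor:
  "matrix_unit p q = matrix_unit (fst p) (fst q) \<otimes>\<^sub>m matrix_unit (snd p) (snd q)"
  by (auto simp: matrix_unit_def tensor_def vec_eq_iff prod_eq_iff)

lemma clinear_map_expand: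
  assumes "clinear_map f"
  shows "f X = (\<Sum>i\<in>UNIV. \<Sum>j\<in>UNIV. cscale (X $ i $ j) (f (matrix_unit i j)))"
proof -
  interpret Vector_Spaces.linear cscale cscale f by fact
  show ?thesis by (subst op_expand[of X]) (simp add: sum scale)
qed

lemma clinear_functional_expand:
  assumes "clinear_functional f"
  shows "f X = (\<Sum>i\<in>UNIV. \<Sum>j\<in>UNIV. X $ i $ j * f (matrix_unit i j))"
proof -
  interpret Vector_Spaces.linear cscale "(*)" f by fact
  show ?thesis by (subst op_expand[of X]) (simp add: sum scale)
qed

lemma trace_mult_matrix_unit: "trace (matrix_unit i j ** B) = B $ j $ i"
proof -
  have "trace (matrix_unit i j ** B) = (\<Sum>k\<in>UNIV. \<Sum>l\<in>UNIV. if k = i then (if l = j then B $ l $ k else 0) else 0)"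
    unfolding trace_def matrix_matrix_mult_def matrix_unit_def
    by (simp, intro sum.cong refl) auto
  also have "\<dots> = (\<Sum>k\<in>UNIV. if k = i then B $ j $ k else 0)"
    by (intro sum.cong refl) auto
  finally show ?thesis by simp
qed

lemma clinear_functional_trace: "clinear_functional (\<lambda>a. trace (a ** b))"
  by (simp add: clinear_functional_iff trace_def matrix_matrix_mult_def cscale_def
      algebra_simps sum.distrib sum_distrib_left)

lemma adjoint_map_unique:
  assumes "\<forall>a b. trace (\<phi> a ** b) = trace (a ** \<psi> b)"
  shows "\<psi> b = (\<chi> j i. trace (\<phi> (matrix_unit i j) ** b))"
  using assms by (simp add: vec_eq_iff trace_mult_matrix_unit)

lemma adjoint_map_spec:
  assumes "clinear_map \<phi>"
  shows "trace (\<phi> a ** b) = trace (a ** adjoint_map \<phi> b)"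
    and "adjoint_map \<phi> b = (\<chi> j i. trace (\<phi> (matrix_unit i j) ** b))"
proof -
  let ?\<psi> = "\<lambda>b. \<chi> j i. trace (\<phi> (matrix_unit i j) ** b)"
  have eq: "trace (\<phi> a ** b) = trace (a ** ?\<psi> b)" for a b
  proof -
    have "clinear_functional (\<lambda>a. trace (\<phi> a ** b))"
      using assms clinear_functional_trace[of b]
      by (simp add: clinear_map_iff clinear_functional_iff)
    from clinear_functional_expand[OF this, of a] show ?thesis
      unfolding clinear_functional_expand[OF clinear_functional_trace, of a]
      by (simp add: trace_mult_matrix_unit)
  qed
  have adj: "adjoint_map \<phi> = ?\<psi>"
    unfolding adjoint_map_def
  proof (rule the_equality)
    show "\<forall>a b. trace (\<phi> a ** b) = trace (a ** ?\<psi> b)" by (intro allI eq)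
    show "\<psi> = ?\<psi>" if "\<forall>a b. trace (\<phi> a ** b) = trace (a ** \<psi> b)" for \<psi>
      using adjoint_map_unique[OF that] by (rule ext)
  qed
  show "trace (\<phi> a ** b) = trace (a ** adjoint_map \<phi> b)"
    unfolding adj by (rule eq)
  show "adjoint_map \<phi> b = ?\<psi> b"
    by (rule fun_cong[OF adj])
qed

lemma tilde_spec:
  assumes "clinear_map \<phi>"
  shows "clinear_functional (tilde \<phi>)"
    and "tilde \<phi> (a \<otimes>\<^sub>m b) = trace (\<phi> a ** transpose b)"
    and "tilde \<phi> X = (\<Sum>p\<in>UNIV. \<Sum>q\<in>UNIV. X $ p $ q *
           trace (\<phi> (matrix_unit (fst p) (fst q)) ** transpose (matrix_unit (snd p) (snd q))))"
proof -
  define T where "T = (\<lambda>X. \<Sum>p\<in>UNIV. \<Sum>q\<in>UNIV. X $ p $ q *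
    trace (\<phi> (matrix_unit (fst p) (fst q)) ** transpose (matrix_unit (snd p) (snd q))))"
  let ?P = "\<lambda>f. clinear_functional f \<and> (\<forall>a b. f (a \<otimes>\<^sub>m b) = trace (\<phi> a ** transpose b))"
  have lin: "clinear_functional T"
    by (simp add: T_def clinear_functional_iff cscale_def algebra_simps sum.distrib sum_distrib_left)
  have "T (a \<otimes>\<^sub>m b) = trace (\<phi> a ** transpose b)" for a b
  proof -
    define g where "g = (\<lambda>a b. trace (\<phi> a ** transpose b))"
    have l1: "clinear_functional (\<lambda>a. g a b)" for b
      using assms clinear_functional_trace[of "transpose b"]
      by (simp add: g_def clinear_map_iff clinear_functional_iff)
    have l2: "clinear_functional (g a)" for a
      by (simp add: g_def clinear_functional_iff trace_def matrix_matrix_mult_def cscale_def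
          transpose_def algebra_simps sum.distrib sum_distrib_left)
    have "g a b = (\<Sum>i\<in>UNIV. \<Sum>j\<in>UNIV. \<Sum>k\<in>UNIV. \<Sum>l\<in>UNIV.
        a $ i $ j * b $ k $ l * g (matrix_unit i j) (matrix_unit k l))"
      by (subst clinear_functional_expand[OF l1], subst clinear_functional_expand[OF l2])
        (simp add: sum_distrib_left mult.assoc)
    also have "\<dots> = (\<Sum>i\<in>UNIV. \<Sum>k\<in>UNIV. \<Sum>j\<in>UNIV. \<Sum>l\<in>UNIV.
        a $ i $ j * b $ k $ l * g (matrix_unit i j) (matrix_unit k l))"
      by (intro sum.cong refl sum.swap)
    also have "\<dots> = T (a \<otimes>\<^sub>m b)"
      by (simp add: T_def tensor_def g_def sum_UNIV_prod)
    finally show ?thesis by (simp add: g_def)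
  qed
  with lin have "?P T" by blast
  moreover have "f = T" if "?P f" for f
  proof
    fix X
    from that have "clinear_functional f" by blast
    from clinear_functional_expand[OF this, of X] show "f X = T X"
      using that by (simp add: T_def matrix_unit_tensor)
  qed
  ultimately have eq: "tilde \<phi> = T" unfolding tilde_def by (rule the_equality)
  with \<open>?P T\<close> show "clinear_functional (tilde \<phi>)"
    and "tilde \<phi> (a \<otimes>\<^sub>m b) = trace (\<phi> a ** transpose b)"
    by simp_all
  from eq show "tilde \<phi> X = (\<Sum>p\<in>UNIV. \<Sum>q\<in>UNIV. X $ p $ q *
           trace (\<phi> (matrix_unit (fst p) (fst q)) ** transpose (matrix_unit (snd p) (snd q))))"
    by (simp only: T_def)
qed

lemma tensor_map_spec:
  assumes "clinear_map \<phi>" and "clinear_map \<psi>"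
  shows "clinear_map (tensor_map \<phi> \<psi>)"
    and "tensor_map \<phi> \<psi> (a \<otimes>\<^sub>m b) = \<phi> a \<otimes>\<^sub>m \<psi> b"
    and "tensor_map \<phi> \<psi> X = (\<Sum>p\<in>UNIV. \<Sum>q\<in>UNIV. cscale (X $ p $ q)
           (\<phi> (matrix_unit (fst p) (fst q)) \<otimes>\<^sub>m \<psi> (matrix_unit (snd p) (snd q))))"
proof -
  define T where "T = (\<lambda>X. \<Sum>p\<in>UNIV. \<Sum>q\<in>UNIV. cscale (X $ p $ q)
    (\<phi> (matrix_unit (fst p) (fst q)) \<otimes>\<^sub>m \<psi> (matrix_unit (snd p) (snd q))))"
  let ?P = "\<lambda>F. clinear_map F \<and> (\<forall>a b. F (a \<otimes>\<^sub>m b) = \<phi> a \<otimes>\<^sub>m \<psi> b)"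
  have lin: "clinear_map T"
    by (simp add: T_def clinear_map_iff cscale_def vec_eq_iff algebra_simps sum.distrib
        sum_distrib_left)
  have "T (a \<otimes>\<^sub>m b) = \<phi> a \<otimes>\<^sub>m \<psi> b" for a b
  proof -
    have "(\<phi> a \<otimes>\<^sub>m \<psi> b) $ r $ s = T (a \<otimes>\<^sub>m b) $ r $ s" for r s
    proof -
      define g where "g = (\<lambda>i j k l. \<phi> (matrix_unit i j) $ fst r $ fst s * \<psi> (matrix_unit k l) $ snd r $ snd s)"
      have "(\<phi> a \<otimes>\<^sub>m \<psi> b) $ r $ s =
          (\<Sum>i\<in>UNIV. \<Sum>j\<in>UNIV. a $ i $ j * \<phi> (matrix_unit i j) $ fst r $ fst s) *
          (\<Sum>k\<in>UNIV. \<Sum>l\<in>UNIV. b $ k $ l * \<psi> (matrix_unit k l) $ snd r $ snd s)"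
        by (simp add: tensor_def clinear_map_expand[OF assms(1), of a]
            clinear_map_expand[OF assms(2), of b] cscale_def)
      also have "\<dots> = (\<Sum>i\<in>UNIV. \<Sum>j\<in>UNIV. \<Sum>k\<in>UNIV. \<Sum>l\<in>UNIV. a $ i $ j * b $ k $ l * g i j k l)"
        unfolding sum_distrib_right unfolding sum_distrib_left g_def
        by (intro sum.cong refl) (simp add: mult_ac)
      also have "\<dots> = (\<Sum>i\<in>UNIV. \<Sum>k\<in>UNIV. \<Sum>j\<in>UNIV. \<Sum>l\<in>UNIV. a $ i $ j * b $ k $ l * g i j k l)"
        by (intro sum.cong refl sum.swap)
      also have "\<dots> = (\<Sum>p\<in>UNIV. \<Sum>q\<in>UNIV.
          a $ fst p $ fst q * b $ snd p $ snd q * g (fst p) (fst q) (snd p) (snd q))"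
        by (simp add: sum_UNIV_prod)
      also have "\<dots> = T (a \<otimes>\<^sub>m b) $ r $ s"
        by (simp add: T_def tensor_def cscale_def g_def)
      finally show ?thesis .
    qed
    then show ?thesis by (simp add: vec_eq_iff)
  qed
  with lin have "?P T" by blast
  moreover have "F = T" if "?P F" for F
  proof
    fix X
    from that have "clinear_map F" by blast
    from clinear_map_expand[OF this, of X] show "F X = T X"
      using that by (simp add: T_def matrix_unit_tensor)
  qed
  ultimately have eq: "tensor_map \<phi> \<psi> = T" unfolding tensor_map_def by (rule the_equality)
  with \<open>?P T\<close> show "clinear_map (tensor_map \<phi> \<psi>)"
    and "tensor_map \<phi> \<psi> (a \<otimes>\<^sub>m b) = \<phi> a \<otimes>\<^sub>m \<psi> b"
    by simp_all
  from eq show "tensor_map \<phi> \<psi> X = (\<Sum>p\<in>UNIV. \<Sum>q\<in>UNIV. cscale (X $ p $ q)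
           (\<phi> (matrix_unit (fst p) (fst q)) \<otimes>\<^sub>m \<psi> (matrix_unit (snd p) (snd q))))"
    by (simp only: T_def)
qed

end

theory Submission
  imports Defs
begin

text \<open>
  All five conditions are statements about the pairing \<open>Tr (h C\<^sub>\<alpha>)\<close>. The map with Choi matrix
  \<open>h\<^sup>t\<close> represents \<open>\<rho>\<close>; it is positive because a mapping cone contains every rank one map
  \<open>x \<mapsto> \<langle>x u, u\<rangle> v v\<^sup>*\<close>, obtained by compressing a nonzero element on both sides. This links (i) and
  (ii). The quadratic form of \<open>(\<iota> \<otimes> \<alpha>)(h)\<close> at \<open>v\<close> is \<open>Tr (h C\<^sub>\<beta>)\<close> with \<open>\<beta>\<close> again in the cone, and
  the vector \<open>\<Sum>\<^sub>i e\<^sub>i \<otimes> e\<^sub>i\<close> recovers every element of the cone as such a \<open>\<beta>\<close>, which links (ii)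
  and (iii). Self-duality of the positive matrices links (iii) and (iv). The dual cone is closed
  under the same operations, so the equivalence of (ii) and (iii) holds for it as well; hence the
  cone in (v) consists of the \<open>x\<close> with \<open>Tr (x C\<^sub>\<beta>) \<ge> 0\<close> for all \<open>\<beta>\<close> in the dual cone. It contains
  \<open>C\<^sub>\<alpha>\<close> for \<open>\<alpha> \<in> K\<close>, and by (i) \<open>\<rho>\<close> is the pairing with the Choi matrix of an element of the dual
  cone, so no bipolar theorem is needed.
\<close>

section \<open>Sesquilinear forms, rank one matrices and blocks\<close>

definition sesq :: "('n::finite) op \<Rightarrow> complex ^ 'n \<Rightarrow> complex ^ 'n \<Rightarrow> complex" where
  "sesq A u v = (\<Sum>i\<in>UNIV. \<Sum>j\<in>UNIV. cnj (u $ i) * A $ i $ j * v $ j)"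

definition outer :: "complex ^ ('n::finite) \<Rightarrow> 'n op" where
  "outer v = (\<chi> i j. v $ i * cnj (v $ j))"

definition dagger :: "('n::finite) op \<Rightarrow> 'n op" where
  "dagger V = (\<chi> i j. cnj (V $ j $ i))"

definition conj_map :: "('n::finite) op \<Rightarrow> 'n opmap" where
  "conj_map V x = V ** x ** dagger V"

text \<open>The view of operators on the tensor square as matrices with entries in B(H): the map
  \<iota> \<otimes> \<alpha> acts on them entrywise, and the entries of a Choi matrix are the images
  of the matrix units.\<close>

definition block :: "('m::finite \<times> 'n::finite) op \<Rightarrow> 'm \<Rightarrow> 'm \<Rightarrow> 'n op" where
  "block X i j = (\<chi> k l. X $ (i, k) $ (j, l))"

lemma cinner_eq_sesq: "cinner (A *v v) u = sesq A u v"
  by (simp add: cinner_def sesq_def matrix_vector_mult_def sum_distrib_left sum_distrib_right mult_ac)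

lemma sum_matrix_unit: "(\<Sum>k\<in>UNIV. \<Sum>l\<in>UNIV. matrix_unit i j $ k $ l * f k l) = f i j"
proof -
  have "(\<Sum>k\<in>UNIV. \<Sum>l\<in>UNIV. matrix_unit i j $ k $ l * f k l) =
      (\<Sum>k\<in>UNIV. if k = i then \<Sum>l\<in>UNIV. if l = j then f k l else 0 else 0)"
  proof (intro sum.cong refl)
    fix k
    have "matrix_unit i j $ k $ l * f k l = (if k = i then if l = j then f k l else 0 else 0)" for l
      by (simp add: matrix_unit_def)
    then show "(\<Sum>l\<in>UNIV. matrix_unit i j $ k $ l * f k l) =
        (if k = i then \<Sum>l\<in>UNIV. if l = j then f k l else 0 else 0)"
      by simp
  qed
  then show ?thesis by simp
qed

lemma psd_iff_sesq: "psd A \<longleftrightarrow> (\<forall>v. sesq A v v \<in> \<real>\<^sub>\<ge>\<^sub>0)"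
  by (simp add: psd_def cinner_eq_sesq)

lemma trace_mult: "trace (A ** B) = (\<Sum>i\<in>UNIV. \<Sum>j\<in>UNIV. A $ i $ j * B $ j $ i)"
  by (simp add: trace_def matrix_matrix_mult_def)

lemma trace_outer: "trace (A ** outer v) = sesq A v v"
  by (simp add: trace_mult sesq_def outer_def mult_ac)

lemma sesq_add_left: "sesq A (u + w) v = sesq A u v + sesq A w v"
  by (simp add: sesq_def algebra_simps sum.distrib)

lemma sesq_add_right: "sesq A u (v + w) = sesq A u v + sesq A u w"
  by (simp add: sesq_def algebra_simps sum.distrib)

lemma sesq_axis_left: "sesq A (axis i s) v = cnj s * (\<Sum>j\<in>UNIV. A $ i $ j * v $ j)"
proof -
  have "sesq A (axis i s) v = (\<Sum>k\<in>UNIV. if k = i then cnj s * (\<Sum>j\<in>UNIV. A $ k $ j * v $ j) else 0)"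
    unfolding sesq_def by (intro sum.cong refl) (auto simp: axis_def sum_distrib_left mult_ac)
  then show ?thesis by simp
qed

lemma sesq_axis_right: "sesq A u (axis j t) = t * (\<Sum>i\<in>UNIV. cnj (u $ i) * A $ i $ j)"
proof -
  have "sesq A u (axis j t) = (\<Sum>i\<in>UNIV. \<Sum>k\<in>UNIV. if k = j then t * (cnj (u $ i) * A $ i $ k) else 0)"
    unfolding sesq_def by (intro sum.cong refl) (auto simp: axis_def mult_ac)
  then show ?thesis by (simp add: sum_distrib_left)
qed

lemma sesq_axis: "sesq A (axis i s) (axis j t) = cnj s * A $ i $ j * t"
proof -
  have "(\<Sum>k\<in>UNIV. A $ i $ k * axis j t $ k) = (\<Sum>k\<in>UNIV. if k = j then A $ i $ k * t else 0)"
    by (intro sum.cong refl) (auto simp: axis_def)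
  then show ?thesis by (simp add: sesq_axis_left)
qed

lemma sesq_axis_sum:
  "sesq A (axis i s + axis j t) (axis i s + axis j t) =
     cnj s * A $ i $ i * s + cnj t * A $ j $ j * t + (cnj s * A $ i $ j * t + cnj t * A $ j $ i * s)"
  by (simp add: sesq_add_left sesq_add_right sesq_axis)

text \<open>Polarization: basis vectors see the diagonal entries, while e_i + e_j and e_i + i e_j
  see the sum and the difference of the entries at (i, j) and (j, i).\<close>

lemma eq_zero_if_sesq_zero:
  assumes "\<And>v. sesq A v v = 0"
  shows "A = 0"
proof -
  have d: "A $ i $ i = 0" for i
    using assms[of "axis i 1"] by (simp add: sesq_axis)
  have "A $ i $ j = 0" for i j
    using assms[of "axis i 1 + axis j 1"] assms[of "axis i 1 + axis j \<i>"]
    unfolding sesq_axis_sum d by (simp add: complex_eq_iff)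
  then show ?thesis by (simp add: vec_eq_iff)
qed

section \<open>Positive matrices and self-duality of their cone\<close>

lemma psd_diag: "psd A \<Longrightarrow> A $ i $ i \<in> \<real>\<^sub>\<ge>\<^sub>0"
  unfolding psd_iff_sesq by (drule spec[of _ "axis i 1"]) (simp add: sesq_axis)

text \<open>Over the complex numbers real form values already force hermitian symmetry, by the same
  two test vectors as in the polarization above.\<close>

lemma psd_hermitian:
  assumes "psd A"
  shows "A $ j $ i = cnj (A $ i $ j)"
proof -
  have d: "Im (A $ i $ i) = 0" for i
    using psd_diag[OF assms, of i] by (simp add: complex_nonneg_Reals_iff)
  have q: "Im (sesq A v v) = 0" for v
    using assms by (auto simp: psd_iff_sesq complex_nonneg_Reals_iff)
  show ?thesis
    using q[of "axis i 1 + axis j 1"] q[of "axis i 1 + axis j \<i>"]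
    unfolding sesq_axis_sum by (simp add: complex_eq_iff d)
qed

lemma psd_zero_diag:
  assumes "psd A" and "A $ i $ i = 0"
  shows "A $ i $ k = 0"
proof (rule ccontr)
  assume nz: "A $ i $ k \<noteq> 0"
  define z where "z = A $ i $ k"
  define N where "N = (cmod z)\<^sup>2"
  \<comment> \<open>Chosen so that the form at \<open>?v\<close> below has real part Re (A_kk) - 2 t
    N = -1, against positivity.\<close>
  define t where "t = (Re (A $ k $ k) + 1) / (2 * N)"
  have N: "N > 0" using nz by (simp add: N_def z_def)
  have zz: "z * cnj z = of_real N" by (metis N_def complex_norm_square of_real_power)
  have ki: "A $ k $ i = cnj z" using psd_hermitian[OF assms(1), of k i] by (simp add: z_def)
  let ?v = "axis i (- of_real t * z) + axis k 1"
  have "sesq A ?v ?v = A $ k $ k - of_real t * (z * cnj z) - of_real t * (z * cnj z)"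
    unfolding sesq_axis_sum assms(2) ki z_def[symmetric] by (simp add: mult_ac)
  also have "Re \<dots> = -1"
    unfolding zz using N by (simp add: t_def field_simps)
  finally have "Re (sesq A ?v ?v) = -1" .
  moreover have "Re (sesq A ?v ?v) \<ge> 0"
    using assms(1) by (auto simp: psd_iff_sesq complex_nonneg_Reals_iff)
  ultimately show False by simp
qed

text \<open>Completing the square: the form of the Schur complement at \<open>v\<close> is the form
  of \<open>A\<close> at a vector differing from \<open>v\<close> only in coordinate
  \<open>k\<close>.\<close>

lemma psd_schur_complement:
  fixes A :: "('n::finite) op"
  assumes "psd A" and "A $ k $ k \<noteq> 0"
  shows "psd (\<chi> i j. A $ i $ j - A $ i $ k * A $ k $ j / A $ k $ k)" (is "psd ?B")
  unfolding psd_iff_sesq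
proof
  fix v :: "complex ^ 'n"
  define a where "a = A $ k $ k"
  define c where "c = (\<Sum>j\<in>UNIV. A $ k $ j * v $ j)"
  have a: "a \<noteq> 0" "cnj a = a"
    using assms psd_diag[OF assms(1), of k]
    by (auto simp: a_def complex_nonneg_Reals_iff complex_eq_iff)
  have c: "cnj c = (\<Sum>i\<in>UNIV. cnj (v $ i) * A $ i $ k)"
    unfolding c_def cnj_sum by (intro sum.cong refl) (simp add: psd_hermitian[OF assms(1), symmetric])
  \<comment> \<open>The shift makes entry \<open>k\<close> of \<open>A *v ?w\<close> vanish.\<close>
  let ?w = "v + axis k (- c / a)"
  have "sesq ?B v v = sesq A v v - (\<Sum>i\<in>UNIV. \<Sum>j\<in>UNIV. (cnj (v $ i) * A $ i $ k) * (A $ k $ j * v $ j)) / a"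
    by (simp add: sesq_def a_def algebra_simps sum_subtractf sum_divide_distrib)
  also have "(\<Sum>i\<in>UNIV. \<Sum>j\<in>UNIV. (cnj (v $ i) * A $ i $ k) * (A $ k $ j * v $ j)) = cnj c * c"
    unfolding c unfolding c_def sum_product ..
  also have "sesq A v v - cnj c * c / a = sesq A ?w ?w"
  proof -
    have "sesq A ?w ?w = sesq A v v + (- c / a) * cnj c + cnj (- c / a) * c + cnj (- c / a) * a * (- c / a)"
      unfolding sesq_add_left sesq_add_right sesq_axis
      by (simp only: sesq_axis_left sesq_axis_right a_def[symmetric] c_def[symmetric] c[symmetric] add_ac)
    then show ?thesis using a by simp
  qed
  finally show "sesq ?B v v \<in> \<real>\<^sub>\<ge>\<^sub>0"
    using assms(1) by (simp add: psd_iff_sesq)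
qed

text \<open>A Cholesky decomposition: induction on a set containing all nonzero rows peels rank one
  matrices off \<open>A\<close>, and the trace of such a matrix against \<open>B\<close> is a value
  of the form of \<open>B\<close>.\<close>

lemma trace_mult_nonneg:
  fixes A B :: "('n::finite) op"
  assumes "psd A" and "psd B"
  shows "trace (A ** B) \<in> \<real>\<^sub>\<ge>\<^sub>0"
proof -
  have "trace (A ** B) \<in> \<real>\<^sub>\<ge>\<^sub>0"
    if "finite S" "psd A" "\<forall>i j. i \<notin> S \<longrightarrow> A $ i $ j = 0" for S and A :: "'n op"
    using that
  proof (induction S arbitrary: A rule: finite_induct)
    case empty
    then show ?case by (simp add: trace_mult)
  next
    case (insert k S)
    show ?case
    proof (cases "A $ k $ k = 0")
      case True
      \<comment> \<open>A zero diagonal entry kills its whole row, so \<open>S\<close> already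
        contains all nonzero rows.\<close>
      from psd_zero_diag[OF insert.prems(1) True] insert.prems(2)
      have "\<forall>i j. i \<notin> S \<longrightarrow> A $ i $ j = 0" by (metis insert_iff)
      with insert.IH insert.prems(1) show ?thesis by blast
    next
      case False
      define C where "C = (\<chi> i j. A $ i $ j - A $ i $ k * A $ k $ j / A $ k $ k)"
      have psdC: "psd C" unfolding C_def by (rule psd_schur_complement[OF insert.prems(1) False])
      have "\<forall>i j. i \<notin> S \<longrightarrow> C $ i $ j = 0"
        using insert.prems(2) False by (simp add: C_def) (metis div_0 mult_zero_left nonzero_mult_div_cancel_left)
      from insert.IH[OF psdC this] have 1: "trace (C ** B) \<in> \<real>\<^sub>\<ge>\<^sub>0" .
      \<comment> \<open>By hermitian symmetry row \<open>k\<close> is the conjugate of column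
        \<open>k\<close>, so the part removed from \<open>A\<close> is \<open>outer v\<close>
        divided by the positive number \<open>d\<close>.\<close>
      define v where "v = (\<chi> i. A $ i $ k)"
      define d where "d = A $ k $ k"
      have A: "A $ i $ j = C $ i $ j + outer v $ i $ j / d" for i j
        by (simp add: d_def C_def outer_def v_def psd_hermitian[OF insert.prems(1), symmetric])
      have "trace (A ** B) = trace (C ** B) + trace (outer v ** B) / d"
        unfolding trace_mult A by (simp add: algebra_simps sum.distrib sum_divide_distrib)
      also have "trace (outer v ** B) = sesq B v v"
        using trace_mul_sym trace_outer by metis
      finally show ?thesis
        using 1 assms(2) psd_diag[OF insert.prems(1), of k]
        by (auto simp: d_def psd_iff_sesq intro!: nonneg_Reals_add_I nonneg_Reals_divide_I)
    qed
  qed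
  from this[of UNIV A] assms(1) show ?thesis by simp
qed

lemma psd_outer: "psd (outer v)"
  unfolding psd_iff_sesq
proof
  fix u
  let ?z = "\<Sum>i\<in>UNIV. cnj (u $ i) * v $ i"
  have "sesq (outer v) u u = ?z * cnj ?z"
    unfolding cnj_sum sum_product by (simp add: sesq_def outer_def mult_ac)
  then show "sesq (outer v) u u \<in> \<real>\<^sub>\<ge>\<^sub>0"
    by (simp only: complex_norm_square[symmetric]) simp
qed

lemma psd_iff_trace_outer: "psd A \<longleftrightarrow> (\<forall>v. trace (A ** outer v) \<in> \<real>\<^sub>\<ge>\<^sub>0)"
  by (simp add: psd_iff_sesq trace_outer)

text \<open>Self-duality of the positive cone; the rank one matrices suffice as tests for positivity
  of \<open>A\<close>.\<close>

lemma functional_nonneg_trace: "functional_nonneg (\<lambda>X. trace (A ** X)) \<longleftrightarrow> psd A"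
  unfolding functional_nonneg_def
  by (metis psd_iff_trace_outer psd_outer trace_mult_nonneg)

lemma eq_zero_if_trace_zero:
  fixes a :: "('n::finite) op"
  assumes "\<And>b :: 'n op. trace (a ** b) = 0"
  shows "a = 0"
  by (rule eq_zero_if_sesq_zero) (use assms in \<open>simp flip: trace_outer\<close>)

lemma op_eq_if_trace_eq:
  fixes a b :: "('n::finite) op"
  assumes "\<And>c :: 'n op. trace (a ** c) = trace (b ** c)"
  shows "a = b"
proof -
  have "trace ((a - b) ** c) = 0" for c
    using assms[of c] by (simp add: trace_mult algebra_simps sum_subtractf)
  from eq_zero_if_trace_zero[OF this] show ?thesis by simp
qed

section \<open>Adjoints and transposes of positive maps\<close>

lemma clinear_adjoint_map:
  assumes "clinear_map \<phi>"
  shows "clinear_map (adjoint_map \<phi>)"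
  unfolding clinear_map_iff
  by (auto simp: vec_eq_iff adjoint_map_spec(2)[OF assms] cscale_def trace_mult
      algebra_simps sum.distrib sum_distrib_left)

lemma trace_adjoint_map:
  assumes "clinear_map \<phi>"
  shows "trace (adjoint_map \<phi> a ** b) = trace (a ** \<phi> b)"
  by (metis adjoint_map_spec(1)[OF assms] trace_mul_sym)

text \<open>The trace pairing is bilinear, symmetric by cyclicity and nondegenerate, so taking
  adjoints is an involution.\<close>

lemma adjoint_map_adjoint_map:
  assumes "clinear_map \<phi>"
  shows "adjoint_map (adjoint_map \<phi>) = \<phi>"
proof
  fix a
  show "adjoint_map (adjoint_map \<phi>) a = \<phi> a"
    by (rule op_eq_if_trace_eq)
      (simp add: trace_adjoint_map clinear_adjoint_map assms adjoint_map_spec(1)[OF assms])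
qed

text \<open>The rank one condition makes the adjoint positive on every \<open>outer v\<close>;
  pairing these values with an arbitrary positive \<open>A\<close> and moving the adjoint back shows
  that \<phi>(A) is positive. The condition is symmetric in \<phi> and its adjoint.\<close>

lemma pos_maps_iff_outer:
  assumes "clinear_map \<phi>"
  shows "\<phi> \<in> pos_maps \<longleftrightarrow> (\<forall>u v. trace (\<phi> (outer u) ** outer v) \<in> \<real>\<^sub>\<ge>\<^sub>0)"
proof
  assume "\<phi> \<in> pos_maps"
  then show "\<forall>u v. trace (\<phi> (outer u) ** outer v) \<in> \<real>\<^sub>\<ge>\<^sub>0"
    using psd_outer by (auto simp: pos_maps_def intro: trace_mult_nonneg)
next
  assume *: "\<forall>u v. trace (\<phi> (outer u) ** outer v) \<in> \<real>\<^sub>\<ge>\<^sub>0"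
  have "psd (adjoint_map \<phi> (outer v))" for v
    using * unfolding psd_iff_trace_outer trace_adjoint_map[OF assms]
    by (metis trace_mul_sym)
  then have "psd (\<phi> A)" if "psd A" for A
    using trace_mult_nonneg[OF that]
    by (simp add: psd_iff_trace_outer[of "\<phi> A"] adjoint_map_spec(1)[OF assms])
  with assms show "\<phi> \<in> pos_maps" by (simp add: pos_maps_def)
qed

lemma adjoint_map_in_pos_maps:
  assumes "\<phi> \<in> pos_maps"
  shows "adjoint_map \<phi> \<in> pos_maps"
proof -
  have l: "clinear_map \<phi>" using assms by (simp add: pos_maps_def)
  show ?thesis
    using assms unfolding pos_maps_iff_outer[OF clinear_adjoint_map[OF l]] pos_maps_iff_outer[OF l]
      trace_adjoint_map[OF l] by (metis trace_mul_sym)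
qed

lemma psd_transpose:
  fixes A :: "('n::finite) op"
  assumes "psd A"
  shows "psd (transpose A)"
  unfolding psd_iff_sesq
proof
  fix v :: "complex ^ 'n"
  \<comment> \<open>Transposing the matrix amounts to conjugating the vector in the quadratic
    form.\<close>
  define w where "w = (\<chi> i. cnj (v $ i))"
  have "sesq (transpose A) v v = sesq A w w"
    unfolding sesq_def w_def transpose_def by (subst sum.swap) (simp add: mult_ac)
  with assms show "sesq (transpose A) v v \<in> \<real>\<^sub>\<ge>\<^sub>0" by (simp add: psd_iff_sesq)
qed

lemma transpose_map_in_pos_maps:
  assumes "\<phi> \<in> pos_maps"
  shows "transpose_map \<phi> \<in> pos_maps"
proof -
  have "transpose (a + b) = transpose a + transpose b"
    and "transpose (cscale c a) = cscale c (transpose a)" for a b :: "('k::finite) op" and c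
    by (simp_all add: transpose_def cscale_def vec_eq_iff)
  note tr = this
  from assms show ?thesis
    by (simp add: pos_maps_def transpose_map_def clinear_map_iff psd_transpose tr)
qed

section \<open>Compressions x \<mapsto> V x V*\<close>

lemma conj_map_nth:
  "conj_map V x $ i $ j = (\<Sum>k\<in>UNIV. \<Sum>l\<in>UNIV. V $ i $ k * x $ k $ l * cnj (V $ j $ l))"
  unfolding conj_map_def dagger_def
  by (simp add: matrix_matrix_mult_def sum_distrib_right) (rule sum.swap)

lemma clinear_conj_map: "clinear_map (conj_map V)"
  by (simp add: clinear_map_iff vec_eq_iff conj_map_nth cscale_def algebra_simps sum.distrib
      sum_distrib_left)

lemma sesq_conj_map: "sesq (conj_map V x) u v = sesq x (dagger V *v u) (dagger V *v v)"
proof -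
  have "sesq (conj_map V x) u v = cinner ((V ** x ** dagger V) *v v) u"
    by (simp add: cinner_eq_sesq conj_map_def)
  also have "\<dots> = cinner (V *v (x *v (dagger V *v v))) u"
    by (simp add: matrix_vector_mul_assoc matrix_mul_assoc)
  also have "\<dots> = cinner (x *v (dagger V *v v)) (dagger V *v u)"
  proof -
    have "cinner (V *v w) u = (\<Sum>i\<in>UNIV. \<Sum>j\<in>UNIV. V $ i $ j * w $ j * cnj (u $ i))" for w
      by (simp add: cinner_def matrix_vector_mult_def sum_distrib_right)
    also have "\<dots> w = cinner w (dagger V *v u)" for w
      by (subst sum.swap) (simp add: cinner_def matrix_vector_mult_def dagger_def sum_distrib_left mult_ac)
    finally show ?thesis .
  qed
  finally show ?thesis by (simp add: cinner_eq_sesq)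
qed

text \<open>The block form of the compressed blocks at the vectors \<open>v i\<close> is the
  original block form at \<open>dagger V *v v i\<close>.\<close>

lemma conj_map_in_cp_maps: "conj_map V \<in> cp_maps"
  by (auto simp: cp_maps_def clinear_conj_map block_psd_def cinner_eq_sesq sesq_conj_map)

lemma conj_map_comp_in_pos_maps:
  assumes "\<phi> \<in> pos_maps"
  shows "conj_map V \<circ> \<phi> \<in> pos_maps"
  using assms clinear_conj_map[of V]
  by (auto simp: pos_maps_def clinear_map_iff psd_iff_sesq sesq_conj_map)

lemma conj_map_mat_1: "conj_map (mat 1) x = x"
proof -
  have "dagger (mat 1 :: 'a op) = mat 1"
    by (auto simp: dagger_def mat_def vec_eq_iff)
  then show ?thesis by (simp add: conj_map_def)
qed

lemma trace_conj_map: "trace (conj_map V x ** y) = trace (x ** conj_map (dagger V) y)"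
proof -
  have "dagger (dagger V) = V" by (simp add: dagger_def vec_eq_iff)
  then have "trace (x ** conj_map (dagger V) y) = trace ((x ** (dagger V ** y)) ** V)"
    by (simp add: conj_map_def matrix_mul_assoc)
  also have "\<dots> = trace (V ** (x ** (dagger V ** y)))" by (rule trace_mul_sym)
  finally show ?thesis by (simp add: conj_map_def matrix_mul_assoc)
qed

section \<open>Choi matrices and their trace pairing\<close>

lemma trace_block:
  "trace (X ** Y) = (\<Sum>i\<in>UNIV. \<Sum>j\<in>UNIV. trace (block X i j ** block Y j i))"
proof -
  have "trace (X ** Y) = (\<Sum>i\<in>UNIV. \<Sum>k\<in>UNIV. \<Sum>j\<in>UNIV. \<Sum>l\<in>UNIV.
      X $ (i, k) $ (j, l) * Y $ (j, l) $ (i, k))"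
    by (simp add: trace_mult sum_UNIV_prod)
  also have "\<dots> = (\<Sum>i\<in>UNIV. \<Sum>j\<in>UNIV. \<Sum>k\<in>UNIV. \<Sum>l\<in>UNIV.
      X $ (i, k) $ (j, l) * Y $ (j, l) $ (i, k))"
    by (intro sum.cong refl sum.swap)
  finally show ?thesis by (simp add: block_def trace_mult)
qed

lemma choi_nth: "choi \<phi> $ p $ q = \<phi> (matrix_unit (fst p) (fst q)) $ snd p $ snd q"
proof -
  have "choi \<phi> $ p $ q = (\<Sum>i\<in>UNIV. \<Sum>j\<in>UNIV.
      if fst p = i then (if fst q = j then \<phi> (matrix_unit i j) $ snd p $ snd q else 0) else 0)"
    unfolding choi_def
    by (simp add: tensor_def, intro sum.cong refl) (simp add: matrix_unit_def)
  also have "\<dots> = (\<Sum>i\<in>UNIV. if fst p = i then \<phi> (matrix_unit i (fst q)) $ snd p $ snd q else 0)"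
    by (intro sum.cong refl) auto
  finally show ?thesis by simp
qed

lemma block_choi: "block (choi \<phi>) i j = \<phi> (matrix_unit i j)"
  by (simp add: block_def choi_nth vec_eq_iff)

lemma trace_choi:
  "trace (X ** choi \<phi>) = (\<Sum>i\<in>UNIV. \<Sum>j\<in>UNIV. trace (block X i j ** \<phi> (matrix_unit j i)))"
  by (simp add: trace_block block_choi)

lemma trace_choi_choi:
  "trace (choi \<phi> ** choi \<psi>) =
     (\<Sum>i\<in>UNIV. \<Sum>j\<in>UNIV. trace (\<phi> (matrix_unit i j) ** \<psi> (matrix_unit j i)))"
  by (simp add: trace_choi block_choi)

text \<open>On Choi matrices the adjoint acts as transposition combined with the flip of the tensor
  factors; no conjugation enters because the pairing defining it is bilinear.\<close>

lemma choi_adjoint_map: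
  assumes "clinear_map \<phi>"
  shows "choi (adjoint_map \<phi>) $ (i, k) $ (j, l) = choi \<phi> $ (l, j) $ (k, i)"
  unfolding choi_nth
  by (simp add: adjoint_map_spec(2)[OF assms])
   (metis trace_mul_sym trace_mult_matrix_unit)

text \<open>Transposition and flip are involutions preserving the trace pairing, so they can be
  moved to the other argument by reindexing.\<close>

lemma trace_choi_adjoint:
  assumes "clinear_map \<phi>" and "clinear_map \<psi>"
  shows "trace (choi (adjoint_map \<phi>) ** choi \<psi>) = trace (choi \<phi> ** choi (adjoint_map \<psi>))"
proof -
  have "trace (choi (adjoint_map \<phi>) ** choi \<psi>) = (\<Sum>p\<in>UNIV. \<Sum>q\<in>UNIV.
      choi \<phi> $ prod.swap q $ prod.swap p * choi \<psi> $ q $ p)"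
    unfolding trace_mult by (simp add: sum_UNIV_prod choi_adjoint_map[OF assms(1)])
  also have "\<dots> = (\<Sum>p\<in>UNIV. \<Sum>q\<in>UNIV. choi \<phi> $ q $ p * choi \<psi> $ prod.swap q $ prod.swap p)"
    by (rule sum.reindex_bij_witness[of _ prod.swap prod.swap]; simp;
        rule sum.reindex_bij_witness[of _ prod.swap prod.swap]; simp)
  also have "\<dots> = (\<Sum>q\<in>UNIV. \<Sum>p\<in>UNIV. choi \<phi> $ q $ p * choi \<psi> $ prod.swap q $ prod.swap p)"
    by (rule sum.swap)
  also have "\<dots> = trace (choi \<phi> ** choi (adjoint_map \<psi>))"
    unfolding trace_mult by (simp add: sum_UNIV_prod choi_adjoint_map[OF assms(2)])
  finally show ?thesis .
qed

lemma transpose_matrix_unit: "transpose (matrix_unit i j) = matrix_unit j i"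
  by (auto simp: transpose_def matrix_unit_def vec_eq_iff)

lemma choi_transpose_map: "choi (transpose_map \<phi>) = transpose (choi \<phi>)"
proof -
  have "choi (transpose_map \<phi>) $ p $ q = choi \<phi> $ q $ p" for p q
    by (simp add: choi_nth transpose_map_def transpose_matrix_unit) (simp add: transpose_def)
  then show ?thesis by (simp add: vec_eq_iff transpose_def)
qed

lemma trace_transpose_mult: "trace (transpose A ** B) = trace (A ** transpose (B :: ('n::finite) op))"
  unfolding trace_mult transpose_def by (subst sum.swap) simp

lemma trace_choi_transpose_map:
  "trace (choi (transpose_map \<phi>) ** choi \<psi>) = trace (choi \<phi> ** choi (transpose_map \<psi>))"
  by (simp add: choi_transpose_map trace_transpose_mult)

lemma trace_choi_conj_map:
  "trace (choi (conj_map V \<circ> \<phi>) ** choi \<psi>) = trace (choi \<phi> ** choi (conj_map (dagger V) \<circ> \<psi>))"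
  by (simp add: trace_choi_choi trace_conj_map)

text \<open>Identifies the density operator of the functional: the b^t in its definition turns the
  Choi matrix of \<phi> into its transpose.\<close>

lemma tilde_eq_trace:
  assumes "clinear_map \<phi>"
  shows "tilde \<phi> X = trace (choi (transpose_map \<phi>) ** X)"
proof -
  have "trace (\<phi> (matrix_unit i j) ** transpose (matrix_unit k l)) = \<phi> (matrix_unit i j) $ k $ l" for i j k l
    by (metis transpose_matrix_unit trace_mul_sym trace_mult_matrix_unit)
  then have "tilde \<phi> X = trace (X ** choi (transpose_map \<phi>))"
    unfolding choi_transpose_map by (simp add: tilde_spec(3)[OF assms] trace_mult transpose_def choi_nth)
  then show ?thesis by (rule trans[OF _ trace_mul_sym])
qed

section \<open>The maps \<iota> \<otimes> \<alpha> acting blockwise\<close>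

lemma clinear_id: "clinear_map id"
  by (simp add: clinear_map_iff)

text \<open>After expansion in matrix units, the identity on the first factor selects the single
  block (i, j).\<close>

lemma block_tensor_map:
  assumes "clinear_map \<alpha>"
  shows "block (tensor_map id \<alpha> X) i j = \<alpha> (block X i j)"
proof -
  have "tensor_map id \<alpha> X $ (i, k) $ (j, l) = \<alpha> (block X i j) $ k $ l" for k l
  proof -
    have \<alpha>: "\<alpha> (block X m n) $ k $ l =
        (\<Sum>m'\<in>UNIV. \<Sum>n'\<in>UNIV. X $ (m, m') $ (n, n') * \<alpha> (matrix_unit m' n') $ k $ l)" for m n
      by (subst clinear_map_expand[OF assms]) (simp add: block_def cscale_def)
    have "tensor_map id \<alpha> X $ (i, k) $ (j, l) = (\<Sum>m\<in>UNIV. \<Sum>m'\<in>UNIV. \<Sum>n\<in>UNIV. \<Sum>n'\<in>UNIV.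
        X $ (m, m') $ (n, n') * (matrix_unit m n $ i $ j * \<alpha> (matrix_unit m' n') $ k $ l))"
      by (simp add: tensor_map_spec(3)[OF clinear_id assms] cscale_def tensor_def sum_UNIV_prod)
    also have "\<dots> = (\<Sum>m\<in>UNIV. \<Sum>n\<in>UNIV. matrix_unit i j $ m $ n * \<alpha> (block X m n) $ k $ l)"
    proof -
      have "(\<Sum>m'\<in>UNIV. \<Sum>n\<in>UNIV. \<Sum>n'\<in>UNIV.
          X $ (m, m') $ (n, n') * (matrix_unit m n $ i $ j * \<alpha> (matrix_unit m' n') $ k $ l)) =
        (\<Sum>n\<in>UNIV. matrix_unit i j $ m $ n * \<alpha> (block X m n) $ k $ l)" for m
      proof -
        have "matrix_unit m n $ i $ j = matrix_unit i j $ m $ n" for n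
          by (auto simp: matrix_unit_def)
        note flip = this
        show ?thesis
          unfolding flip by (rule trans[OF sum.swap])
            (simp add: \<alpha> sum_distrib_left mult_ac)
      qed
      then show ?thesis by simp
    qed
    also have "\<dots> = \<alpha> (block X i j) $ k $ l"
      by (rule sum_matrix_unit)
    finally show ?thesis .
  qed
  then show ?thesis by (simp add: vec_eq_iff) (simp add: block_def)
qed

lemma trace_tensor_map_adjoint:
  assumes "clinear_map \<alpha>"
  shows "trace (h ** tensor_map id \<alpha> X) = trace (tensor_map id (adjoint_map \<alpha>) h ** X)"
  by (simp add: trace_block block_tensor_map assms clinear_adjoint_map trace_adjoint_map)

text \<open>
  Reshape \<open>v \<in> H \<otimes> H\<close> into an operator \<open>V\<close>: compressing \<open>(\<iota> \<otimes> \<alpha>)(h)\<close> by \<open>v\<close> amounts to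
  pairing \<open>h\<close> with the Choi matrix of the adjoint of \<open>x \<mapsto> V \<alpha>(x) V\<^sup>*\<close>, a map in the same cone.
\<close>

lemma sesq_tensor_map:
  assumes "clinear_map \<alpha>"
  shows "sesq (tensor_map id \<alpha> h) v v =
    trace (h ** choi (adjoint_map (conj_map (\<chi> i k. cnj (v $ (i, k))) \<circ> \<alpha>)))"
    (is "_ = trace (h ** choi (adjoint_map (conj_map ?V \<circ> \<alpha>)))")
proof -
  have l: "clinear_map (conj_map ?V \<circ> \<alpha>)"
    using assms clinear_conj_map[of ?V] by (simp add: clinear_map_iff)
  have "sesq (tensor_map id \<alpha> h) v v = (\<Sum>i\<in>UNIV. \<Sum>k\<in>UNIV. \<Sum>j\<in>UNIV. \<Sum>l\<in>UNIV.
      cnj (v $ (i, k)) * block (tensor_map id \<alpha> h) i j $ k $ l * v $ (j, l))"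
    by (simp add: sesq_def sum_UNIV_prod block_def)
  also have "\<dots> = (\<Sum>i\<in>UNIV. \<Sum>j\<in>UNIV. \<Sum>k\<in>UNIV. \<Sum>l\<in>UNIV.
      cnj (v $ (i, k)) * \<alpha> (block h i j) $ k $ l * v $ (j, l))"
    unfolding block_tensor_map[OF assms] by (intro sum.cong refl sum.swap)
  also have "\<dots> = (\<Sum>i\<in>UNIV. \<Sum>j\<in>UNIV. trace ((conj_map ?V \<circ> \<alpha>) (block h i j) ** matrix_unit j i))"
    by (subst trace_mul_sym) (simp add: trace_mult_matrix_unit conj_map_nth)
  also have "\<dots> = trace (h ** choi (adjoint_map (conj_map ?V \<circ> \<alpha>)))"
    by (simp only: trace_choi adjoint_map_spec(1)[OF l])
  finally show ?thesis .
qed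

text \<open>Stated for any set of positive maps closed under adjoints and left compressions, so that
  it applies both to the mapping cone and to its dual cone.\<close>

lemma choi_nonneg_iff_tensor_psd:
  assumes "L \<subseteq> pos_maps"
    and adj: "\<And>\<alpha>. \<alpha> \<in> L \<Longrightarrow> adjoint_map \<alpha> \<in> L"
    and conj: "\<And>\<alpha> V. \<alpha> \<in> L \<Longrightarrow> conj_map V \<circ> \<alpha> \<in> L"
  shows "(\<forall>\<alpha>\<in>L. trace (h ** choi \<alpha>) \<in> \<real>\<^sub>\<ge>\<^sub>0) \<longleftrightarrow> (\<forall>\<alpha>\<in>L. psd (tensor_map id \<alpha> h))"
proof -
  have lin: "clinear_map \<alpha>" if "\<alpha> \<in> L" for \<alpha>
    using assms(1) that by (auto simp: pos_maps_def)
  show ?thesis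
  proof (intro iffI ballI)
    fix \<alpha> assume "\<forall>\<alpha>\<in>L. trace (h ** choi \<alpha>) \<in> \<real>\<^sub>\<ge>\<^sub>0" "\<alpha> \<in> L"
    then show "psd (tensor_map id \<alpha> h)"
      using adj conj lin by (simp add: psd_iff_sesq sesq_tensor_map)
  next
    fix \<alpha> assume *: "\<forall>\<alpha>\<in>L. psd (tensor_map id \<alpha> h)" "\<alpha> \<in> L"
    \<comment> \<open>This vector reshapes to the identity, so the compression disappears and taking
      the adjoint twice restores \<alpha>.\<close>
    define \<omega> :: "complex ^ ('a \<times> 'a)" where "\<omega> = (\<chi> p. if fst p = snd p then 1 else 0)"
    have "(\<chi> i k. cnj (\<omega> $ (i, k))) = mat 1"
      by (auto simp: \<omega>_def mat_def vec_eq_iff)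
    then have "sesq (tensor_map id (adjoint_map \<alpha>) h) \<omega> \<omega> = trace (h ** choi \<alpha>)"
      using lin[OF *(2)]
      by (simp add: sesq_tensor_map clinear_adjoint_map o_def conj_map_mat_1 adjoint_map_adjoint_map)
    then show "trace (h ** choi \<alpha>) \<in> \<real>\<^sub>\<ge>\<^sub>0"
      using * adj by (metis psd_iff_sesq)
  qed
qed

section \<open>Rank one maps inside a mapping cone\<close>

lemma mapping_cone_conj_map:
  assumes "mapping_cone K" and "\<phi> \<in> K"
  shows "conj_map V \<circ> \<phi> \<in> K" and "\<phi> \<circ> conj_map V \<in> K"
  using assms conj_map_in_cp_maps[of V] by (auto simp: mapping_cone_def)

lemma conj_map_rank_one:
  "conj_map (\<chi> i j. u $ i * cnj (v $ j)) x = cscale (sesq x v v) (outer u)"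
  by (simp add: vec_eq_iff conj_map_nth cscale_def sesq_def outer_def sum_distrib_left
      sum_distrib_right mult_ac)

text \<open>These elements are the test maps that force a functional nonnegative on the Choi
  matrices of the cone to come from a positive map.\<close>

lemma rank_one_map_in_mapping_cone:
  fixes K :: "('n::finite) opmap set"
  assumes K: "mapping_cone K"
  shows "(\<lambda>x. cscale (sesq x u u) (outer v)) \<in> K"
proof -
  obtain \<phi> where \<phi>: "\<phi> \<in> K" "\<phi> \<noteq> (\<lambda>x. 0)" using K unfolding mapping_cone_def by blast
  then have pos: "\<phi> \<in> pos_maps" using K unfolding mapping_cone_def by blast
  then have lin: "clinear_map \<phi>" by (simp add: pos_maps_def)
  \<comment> \<open>If all these values vanished, \<phi> would kill every rank one matrix; the
    adjoint would then have zero form everywhere, and \<phi> would be zero.\<close>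
  obtain z y where zy: "sesq (\<phi> (outer z)) y y \<noteq> 0"
  proof (rule ccontr)
    assume "\<not> thesis"
    then have "\<phi> (outer z) = 0" for z
      using that by (intro eq_zero_if_sesq_zero) blast
    then have "sesq (adjoint_map \<phi> b) z z = 0" for b z
      unfolding trace_outer[symmetric] trace_adjoint_map[OF lin] by (simp add: trace_def)
    then have "adjoint_map \<phi> b = 0" for b
      by (rule eq_zero_if_sesq_zero)
    then have "trace (\<phi> a ** b) = 0" for a b
      unfolding adjoint_map_spec(1)[OF lin] by (simp add: trace_def)
    then have "\<phi> a = 0" for a by (rule eq_zero_if_trace_zero)
    with \<phi>(2) show False by blast
  qed
  define r where "r = Re (sesq (\<phi> (outer z)) y y)"
  have "sesq (\<phi> (outer z)) y y \<in> \<real>\<^sub>\<ge>\<^sub>0"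
    using pos psd_outer[of z] by (auto simp: pos_maps_def psd_iff_sesq)
  then have r: "sesq (\<phi> (outer z)) y y = of_real r" "r > 0"
    using zy by (auto simp: r_def complex_nonneg_Reals_iff complex_eq_iff)
  \<comment> \<open>The inner compression by z u* sends \<open>x\<close> to a multiple of
    \<open>outer z\<close> with factor \<open>sesq x u u\<close>; the outer one by v y* sends
    \<phi>(\<open>outer z\<close>) to r times \<open>outer v\<close>.\<close>
  define \<psi> where "\<psi> = conj_map (\<chi> i j. v $ i * cnj (y $ j)) \<circ> (\<phi> \<circ> conj_map (\<chi> i j. z $ i * cnj (u $ j)))"
  have "\<psi> \<in> K" unfolding \<psi>_def by (intro mapping_cone_conj_map K \<phi>)
  then have "(\<lambda>x. inverse r *\<^sub>R \<psi> x) \<in> K"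
    using K r(2) by (auto simp: mapping_cone_def)
  moreover have "inverse r *\<^sub>R \<psi> x = cscale (sesq x u u) (outer v)" for x
  proof -
    have sc: "sesq (cscale c A) y y = c * sesq A y y" for c A
      by (simp add: sesq_def cscale_def sum_distrib_left mult_ac)
    have "\<psi> x = cscale (sesq x u u * of_real r) (outer v)"
      using lin r(1) by (simp add: \<psi>_def conj_map_rank_one clinear_map_iff sc)
    then show ?thesis
      using r(2) by (simp add: cscale_def vec_eq_iff) (simp add: scaleR_conv_of_real)
  qed
  ultimately show ?thesis by simp
qed

section \<open>From Choi matrices to elements of the dual cone\<close>

lemma ex_map_with_choi: "\<exists>\<phi>. clinear_map \<phi> \<and> choi \<phi> = X"
proof (intro exI conjI)
  let ?\<phi> = "\<lambda>a. \<chi> k l. \<Sum>i\<in>UNIV. \<Sum>j\<in>UNIV. a $ i $ j * X $ (i, k) $ (j, l)"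
  show "clinear_map ?\<phi>"
    by (simp add: clinear_map_iff cscale_def vec_eq_iff algebra_simps sum.distrib sum_distrib_left)
  show "choi ?\<phi> = X" by (simp add: vec_eq_iff choi_nth sum_matrix_unit)
qed

text \<open>The Choi matrix of the rank one map is the transpose of \<open>outer u\<close> tensored
  with \<open>outer v\<close>, so pairing with it evaluates \<phi> at
  \<open>outer u\<close>.\<close>

lemma trace_choi_rank_one_map:
  assumes "clinear_map \<phi>"
  shows "trace (choi \<phi> ** choi (\<lambda>x. cscale (sesq x u u) (outer v))) = trace (\<phi> (outer u) ** outer v)"
proof -
  have "sesq (matrix_unit j i) u u = outer u $ i $ j" for i j
    by (metis trace_mult_matrix_unit trace_outer)
  then have "trace (choi \<phi> ** choi (\<lambda>x. cscale (sesq x u u) (outer v))) =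
      (\<Sum>i\<in>UNIV. \<Sum>j\<in>UNIV. trace (\<phi> (matrix_unit i j) ** cscale (outer u $ i $ j) (outer v)))"
    by (simp add: trace_choi_choi)
  also have "\<dots> = (\<Sum>i\<in>UNIV. \<Sum>j\<in>UNIV. outer u $ i $ j * trace (\<phi> (matrix_unit i j) ** outer v))"
    by (simp add: trace_mult cscale_def sum_distrib_left mult_ac)
  also have "\<dots> = trace (\<phi> (outer u) ** outer v)"
  proof -
    have "clinear_functional (\<lambda>a. trace (\<phi> a ** outer v))"
      using assms clinear_functional_trace[of "outer v"]
      by (simp add: clinear_map_iff clinear_functional_iff)
    from clinear_functional_expand[OF this, of "outer u"] show ?thesis by simp
  qed
  finally show ?thesis .
qed

text \<open>Positivity of \<phi>, which \<open>dual_cone\<close> demands, follows from the pairing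
  with the rank one maps of the cone.\<close>

lemma in_dual_cone_if_trace_nonneg:
  assumes "mapping_cone K" and "clinear_map \<phi>"
    and "\<And>\<alpha>. \<alpha> \<in> K \<Longrightarrow> trace (choi \<phi> ** choi \<alpha>) \<in> \<real>\<^sub>\<ge>\<^sub>0"
  shows "\<phi> \<in> dual_cone K"
proof -
  have "\<phi> \<in> pos_maps"
    unfolding pos_maps_iff_outer[OF assms(2)]
    using assms(3)[OF rank_one_map_in_mapping_cone[OF assms(1)]]
    by (simp add: trace_choi_rank_one_map[OF assms(2)])
  with assms(3) show ?thesis by (simp add: dual_cone_def)
qed

theorem theorem10:
  fixes K :: "('n::finite) opmap set"
    and \<rho> :: "('n \<times> 'n) op \<Rightarrow> complex"
    and h :: "('n \<times> 'n) op"
  assumes "mapping_cone K" and "symmetric_cone K"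
    and "clinear_functional \<rho>" and "is_density \<rho> h"
  shows "((\<exists>\<phi>\<in>dual_cone K. \<rho> = tilde \<phi>) \<longleftrightarrow>
          (\<forall>\<alpha>\<in>K. \<rho> (choi \<alpha>) \<in> \<real>\<^sub>\<ge>\<^sub>0)) \<and>
         ((\<forall>\<alpha>\<in>K. \<rho> (choi \<alpha>) \<in> \<real>\<^sub>\<ge>\<^sub>0) \<longleftrightarrow>
          (\<forall>\<alpha>\<in>K. psd (tensor_map id \<alpha> h))) \<and>
         ((\<forall>\<alpha>\<in>K. psd (tensor_map id \<alpha> h)) \<longleftrightarrow>
          (\<forall>\<alpha>\<in>K. functional_nonneg (\<rho> \<circ> tensor_map id \<alpha>))) \<and>
         ((\<forall>\<alpha>\<in>K. functional_nonneg (\<rho> \<circ> tensor_map id \<alpha>)) \<longleftrightarrow>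
          (\<forall>x \<in> {x. \<forall>\<alpha>\<in>dual_cone K. psd (tensor_map id \<alpha> x)}. \<rho> x \<in> \<real>\<^sub>\<ge>\<^sub>0))"
proof -
  have K_pos: "K \<subseteq> pos_maps" using assms(1) unfolding mapping_cone_def by blast
  have K_lin: "clinear_map \<alpha>" if "\<alpha> \<in> K" for \<alpha>
    using K_pos that by (auto simp: pos_maps_def)
  have D_pos: "dual_cone K \<subseteq> pos_maps" by (auto simp: dual_cone_def)
  have D_lin: "clinear_map \<alpha>" if "\<alpha> \<in> dual_cone K" for \<alpha>
    using D_pos that by (auto simp: pos_maps_def)
  have K_adj: "adjoint_map \<alpha> \<in> K" and K_tr: "transpose_map \<alpha> \<in> K" if "\<alpha> \<in> K" for \<alpha>
    using assms(2) K_pos that unfolding symmetric_cone_def by blast+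
  have K_conj: "conj_map V \<circ> \<alpha> \<in> K" if "\<alpha> \<in> K" for \<alpha> V
    by (rule mapping_cone_conj_map[OF assms(1) that])
  \<comment> \<open>Each symmetry of the cone moves across the trace pairing, so the dual cone
    inherits it; likewise for transposes and compressions below.\<close>
  have D_adj: "adjoint_map \<phi> \<in> dual_cone K" if "\<phi> \<in> dual_cone K" for \<phi>
    using that K_adj trace_choi_adjoint[OF D_lin[OF that] K_lin]
    by (simp add: dual_cone_def adjoint_map_in_pos_maps)
  have D_tr: "transpose_map \<phi> \<in> dual_cone K" if "\<phi> \<in> dual_cone K" for \<phi>
    using that K_tr by (simp add: dual_cone_def transpose_map_in_pos_maps trace_choi_transpose_map)
  have D_conj: "conj_map V \<circ> \<phi> \<in> dual_cone K" if "\<phi> \<in> dual_cone K" for \<phi> V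
    using that K_conj by (simp add: dual_cone_def conj_map_comp_in_pos_maps trace_choi_conj_map)
  have \<rho>: "\<rho> x = trace (h ** x)" for x using assms(4) by (simp add: is_density_def)

  have i_ii: "(\<exists>\<phi>\<in>dual_cone K. \<rho> = tilde \<phi>) \<longleftrightarrow> (\<forall>\<alpha>\<in>K. \<rho> (choi \<alpha>) \<in> \<real>\<^sub>\<ge>\<^sub>0)"
  proof
    assume "\<exists>\<phi>\<in>dual_cone K. \<rho> = tilde \<phi>"
    then obtain \<phi> where \<phi>: "\<phi> \<in> dual_cone K" and \<rho>\<phi>: "\<rho> = tilde \<phi>" by blast
    show "\<forall>\<alpha>\<in>K. \<rho> (choi \<alpha>) \<in> \<real>\<^sub>\<ge>\<^sub>0"
      using D_tr[OF \<phi>] unfolding \<rho>\<phi> tilde_eq_trace[OF D_lin[OF \<phi>]] by (simp add: dual_cone_def)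
  next
    assume ii: "\<forall>\<alpha>\<in>K. \<rho> (choi \<alpha>) \<in> \<real>\<^sub>\<ge>\<^sub>0"
    \<comment> \<open>The transpose compensates for the one in the density operator of
      \<open>tilde \<phi>\<close>.\<close>
    obtain \<phi> where \<phi>: "clinear_map \<phi>" "choi \<phi> = transpose h" using ex_map_with_choi by blast
    have "\<phi> \<in> dual_cone K"
    proof (rule in_dual_cone_if_trace_nonneg[OF assms(1) \<phi>(1)])
      fix \<alpha> assume "\<alpha> \<in> K"
      with ii K_tr have "\<rho> (choi (transpose_map \<alpha>)) \<in> \<real>\<^sub>\<ge>\<^sub>0" by blast
      then show "trace (choi \<phi> ** choi \<alpha>) \<in> \<real>\<^sub>\<ge>\<^sub>0"
        unfolding \<phi>(2) trace_transpose_mult \<rho> choi_transpose_map .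
    qed
    moreover have "\<rho> = tilde \<phi>"
      by (rule ext) (simp add: \<rho> tilde_eq_trace \<phi> choi_transpose_map)
    ultimately show "\<exists>\<phi>\<in>dual_cone K. \<rho> = tilde \<phi>" by blast
  qed

  have ii_iii: "(\<forall>\<alpha>\<in>K. \<rho> (choi \<alpha>) \<in> \<real>\<^sub>\<ge>\<^sub>0) \<longleftrightarrow> (\<forall>\<alpha>\<in>K. psd (tensor_map id \<alpha> h))"
    unfolding \<rho> by (rule choi_nonneg_iff_tensor_psd[OF K_pos K_adj K_conj])

  have iv: "functional_nonneg (\<rho> \<circ> tensor_map id \<alpha>) \<longleftrightarrow> psd (tensor_map id (adjoint_map \<alpha>) h)"
    if "\<alpha> \<in> K" for \<alpha>
    unfolding o_def \<rho> trace_tensor_map_adjoint[OF K_lin[OF that]] by (rule functional_nonneg_trace)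
  have iii_iv: "(\<forall>\<alpha>\<in>K. psd (tensor_map id \<alpha> h)) \<longleftrightarrow> (\<forall>\<alpha>\<in>K. functional_nonneg (\<rho> \<circ> tensor_map id \<alpha>))"
  proof (intro iffI ballI)
    fix \<alpha> assume "\<forall>\<alpha>\<in>K. psd (tensor_map id \<alpha> h)" "\<alpha> \<in> K"
    then show "functional_nonneg (\<rho> \<circ> tensor_map id \<alpha>)" using iv K_adj by blast
  next
    fix \<alpha> assume *: "\<forall>\<alpha>\<in>K. functional_nonneg (\<rho> \<circ> tensor_map id \<alpha>)" "\<alpha> \<in> K"
    from iv[OF K_adj[OF *(2)]] *(1) K_adj[OF *(2)] show "psd (tensor_map id \<alpha> h)"
      unfolding adjoint_map_adjoint_map[OF K_lin[OF *(2)]] by blast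
  qed

  have mem: "(\<forall>\<phi>\<in>dual_cone K. psd (tensor_map id \<phi> x)) \<longleftrightarrow>
      (\<forall>\<phi>\<in>dual_cone K. trace (x ** choi \<phi>) \<in> \<real>\<^sub>\<ge>\<^sub>0)" for x
    by (rule choi_nonneg_iff_tensor_psd[OF D_pos D_adj D_conj, symmetric])
  have ii_v: "(\<forall>\<alpha>\<in>K. \<rho> (choi \<alpha>) \<in> \<real>\<^sub>\<ge>\<^sub>0) \<longleftrightarrow>
      (\<forall>x \<in> {x. \<forall>\<alpha>\<in>dual_cone K. psd (tensor_map id \<alpha> x)}. \<rho> x \<in> \<real>\<^sub>\<ge>\<^sub>0)"
    unfolding mem
  proof
    assume "\<forall>\<alpha>\<in>K. \<rho> (choi \<alpha>) \<in> \<real>\<^sub>\<ge>\<^sub>0"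
    then obtain \<phi> where \<phi>: "\<phi> \<in> dual_cone K" and \<rho>\<phi>: "\<rho> = tilde \<phi>" using i_ii by blast
    show "\<forall>x \<in> {x. \<forall>\<phi>\<in>dual_cone K. trace (x ** choi \<phi>) \<in> \<real>\<^sub>\<ge>\<^sub>0}. \<rho> x \<in> \<real>\<^sub>\<ge>\<^sub>0"
      \<comment> \<open>The functional pairs with the Choi matrix of the transposed map, which is
        again in the dual cone, so membership of \<open>x\<close> gives the claim directly.\<close>
      using D_tr[OF \<phi>] unfolding \<rho>\<phi> tilde_eq_trace[OF D_lin[OF \<phi>]]
      by (subst trace_mul_sym) blast
  next
    assume "\<forall>x \<in> {x. \<forall>\<phi>\<in>dual_cone K. trace (x ** choi \<phi>) \<in> \<real>\<^sub>\<ge>\<^sub>0}. \<rho> x \<in> \<real>\<^sub>\<ge>\<^sub>0"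
    \<comment> \<open>Each Choi matrix from the cone satisfies the inequalities defining the set in
      (v), by symmetry of the pairing.\<close>
    moreover have "\<forall>\<phi>\<in>dual_cone K. trace (choi \<alpha> ** choi \<phi>) \<in> \<real>\<^sub>\<ge>\<^sub>0" if "\<alpha> \<in> K" for \<alpha>
      using that by (subst trace_mul_sym) (auto simp: dual_cone_def)
    ultimately show "\<forall>\<alpha>\<in>K. \<rho> (choi \<alpha>) \<in> \<real>\<^sub>\<ge>\<^sub>0" by blast
  qed

  show ?thesis
    by (rule conjI[OF i_ii conjI[OF ii_iii conjI[OF iii_iv trans[OF trans[OF iii_iv[symmetric] ii_iii[symmetric]] ii_v]]]])
qed

end
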